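(* Let $n\ge 1$, $\Omega=[0,1]$, and let $\alpha_{ij}=a_{ij}/b_{ij}\in\mathbb{Q}\cap(0,1]$ with positive integers $a_{ij},b_{ij}$, $\gcd(a_{ij},b_{ij})=1$, for $i,j=1,\dots,n$. Let $\gamma$ be the least common multiple of $\{b_{ij}\}_{i,j=1}^n$. Let $g_i$ be continuous on $\Omega$ and $k_{ij}$ continuous on $D=\{(t,s):0\le s\le t\le 1\}$, and assume that one can write $$g_i(t)=\bar g_i(t^{1/\gamma}),\qquad k_{ij}(t,s)=\bar k_{ij}(t^{1/\gamma},s^{1/\gamma}),\qquad i,j=1,\dots,n,$$ where the functions $\bar g_i$ are analytic in a neighborhood of $0$ and the functions $\bar k_{ij}$ are analytic in a neighborhood of $(0,0)$. Let $Y=(y_1,\dots,y_n)$ be the unique continuous solution on $\Omega$ of the system $$y_i(t)=g_i(t)+\sum_{j=1}^n\int_0^t (t-s)^{\alpha_{ij}-1}k_{ij}(t,s)\,y_j(s)\,ds,\qquad i=1,\dots,n,\ t\in\Omega.$$ Then there is a neighborhood of the origin (in $\Omega$) in which, for each $i=1,\dots,n$, the solution has a series representation $$y_i(t)=\sum_{\mu=0}^\infty \bar y_{i,\mu}\,t^{\mu/\gamma},$$ with coefficients $\bar y_{i,\mu}$ determined by the data.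
   Context: All functions are real-valued. Under the continuity assumptions on $g_i$ and $k_{ij}$ the system has a unique continuous solution on $\Omega$; this is taken as known. *)

theory Defs
  imports "HOL-Analysis.Analysis"
begin

text \<open>The library's \<open>analytic_on\<close> means complex differentiability; the following are the
  real-analytic notions for functions of one and of two real variables.\<close>

definition real_analytic_at :: "(real \<Rightarrow> real) \<Rightarrow> real \<Rightarrow> bool" where
  "real_analytic_at f z \<longleftrightarrow>
     (\<exists>c r. r > 0 \<and> (\<forall>x. \<bar>x - z\<bar> < r \<longrightarrow> (\<lambda>m. c m * (x - z) ^ m) sums f x))"

definition real_analytic_near :: "(real \<Rightarrow> real) \<Rightarrow> real \<Rightarrow> bool" where
  "real_analytic_near f z \<longleftrightarrow> (\<exists>U. open U \<and> z \<in> U \<and> (\<forall>w\<in>U. real_analytic_at f w))"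

definition real_analytic2_at :: "(real \<times> real \<Rightarrow> real) \<Rightarrow> real \<times> real \<Rightarrow> bool" where
  "real_analytic2_at f z \<longleftrightarrow>
     (\<exists>c r. r > 0 \<and> (\<forall>x y. \<bar>x - fst z\<bar> < r \<and> \<bar>y - snd z\<bar> < r \<longrightarrow>
        ((\<lambda>(p, q). c p q * (x - fst z) ^ p * (y - snd z) ^ q) has_sum f (x, y))
          (UNIV :: (nat \<times> nat) set)))"

definition real_analytic2_near :: "(real \<times> real \<Rightarrow> real) \<Rightarrow> real \<times> real \<Rightarrow> bool" where
  "real_analytic2_near f z \<longleftrightarrow> (\<exists>U. open U \<and> z \<in> U \<and> (\<forall>w\<in>U. real_analytic2_at f w))"

definition triangle_D :: "(real \<times> real) set" where
  "triangle_D = {(t, s). 0 \<le> s \<and> s \<le> t \<and> t \<le> 1}"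

text \<open>At \<open>s = t\<close> the value of \<open>(t - s) powr (\<alpha> - 1)\<close> is \<open>0\<close> by convention. This affects only one
  point of the interval of integration; for \<open>\<alpha> > 0\<close> and continuous \<open>k\<close> and \<open>y\<close> the integrand
  is absolutely integrable.\<close>

definition continuous_volterra_solution ::
  "nat \<Rightarrow> (nat \<Rightarrow> nat \<Rightarrow> real) \<Rightarrow> (nat \<Rightarrow> real \<Rightarrow> real) \<Rightarrow> (nat \<Rightarrow> nat \<Rightarrow> real \<times> real \<Rightarrow> real)
     \<Rightarrow> (nat \<Rightarrow> real \<Rightarrow> real) \<Rightarrow> bool" where
  "continuous_volterra_solution n \<alpha> g k y \<longleftrightarrow>
     (\<forall>i\<in>{1..n}. continuous_on {0..1} (y i)) \<and>
     (\<forall>i\<in>{1..n}. \<forall>t\<in>{0..1}.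
        y i t = g i t +
          (\<Sum>j=1..n. integral {0..t} (\<lambda>s. (t - s) powr (\<alpha> i j - 1) * k i j (t, s) * y j s)))"

text \<open>The power \<open>t\<close> to the \<open>\<mu>/\<gamma>\<close> is written \<open>root \<gamma> t ^ \<mu>\<close> rather than with \<open>powr\<close>, because
  \<open>0 powr 0 = 0\<close>, whereas the term for \<open>\<mu> = 0\<close> has to be the constant \<open>c 0\<close> also at \<open>t = 0\<close>.\<close>

definition has_fractional_series :: "nat \<Rightarrow> (real \<Rightarrow> real) \<Rightarrow> (nat \<Rightarrow> real) \<Rightarrow> real \<Rightarrow> bool" where
  "has_fractional_series \<gamma> f c \<delta> \<longleftrightarrow> (\<forall>t\<in>{0..<\<delta>}. (\<lambda>\<mu>. c \<mu> * root \<gamma> t ^ \<mu>) sums f t)"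

end

theory Submission
  imports Defs "HOL-Complex_Analysis.Cauchy_Integral_Formula"
begin

text \<open>With \<open>s = t * u\<close>, \<open>z = root \<gamma> t\<close> and \<open>\<nu> = \<alpha> * \<gamma>\<close>, which is a positive integer, the
  integral becomes \<open>z ^ \<nu>\<close> times an integral over the unit interval in which a monomial
  \<open>z ^ p * w ^ q * w ^ m\<close>, \<open>w = z * root \<gamma> u\<close>, contributes a constant times \<open>z ^ (p + q + m)\<close>.
  Comparing coefficients gives a recursion for the series, and since \<open>\<nu> \<ge> 1\<close> the recursion is a
  contraction by \<open>1 / 2\<close> for the norms \<open>\<Sum>\<mu>. \<bar>c \<mu>\<bar> * \<rho> ^ \<mu>\<close> with small \<open>\<rho>\<close>, so the series
  converges. The same smallness shows that the difference between a continuous solution and the sum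
  of the series, where it is largest, is at most half of its size, and hence is zero.\<close>

section \<open>Integration over the unit interval against an Abel weight\<close>

text \<open>The normal form of a Volterra integral after \<open>s = t * u\<close>: the variable
  \<open>t\<close> has left both the domain of integration and the weight.\<close>

definition abel_int :: "real \<Rightarrow> (real \<Rightarrow> real) \<Rightarrow> real" where
  "abel_int \<alpha> h = integral {0..1} (\<lambda>u. (1 - u) powr (\<alpha> - 1) * h u)"

text \<open>The reflection of \<open>u\<close> to \<open>1 - u\<close> moves the singularity to
  \<open>0\<close>, where the integral of a power with exponent above \<open>-1\<close> is
  known.\<close>

lemma has_integral_abel_weight:
  fixes \<alpha> :: real
  assumes "\<alpha> > 0"
  shows "((\<lambda>u. (1 - u) powr (\<alpha> - 1)) has_integral 1 / \<alpha>) {0..1}"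
proof -
  have "((\<lambda>x. x powr (\<alpha> - 1)) has_integral (1 powr (\<alpha> - 1 + 1) / (\<alpha> - 1 + 1))) (cbox 0 (1::real))"
    using has_integral_powr_from_0[of "\<alpha> - 1" 1] assms by simp
  from has_integral_affinity[OF this, of "-1" 1] show ?thesis
    by (simp add: image_diff_atLeastAtMost)
qed

text \<open>The weight is nonnegative and integrable, hence absolutely integrable, and a bounded
  measurable factor preserves this.\<close>

lemma abel_integrable:
  fixes \<alpha> :: real
  assumes "\<alpha> > 0" and "continuous_on {0..1} h"
  shows "(\<lambda>u. (1 - u) powr (\<alpha> - 1) * h u) integrable_on {0..1}"
proof -
  have w: "(\<lambda>u. (1 - u) powr (\<alpha> - 1)) absolutely_integrable_on {0..1}"
    using has_integral_abel_weight[OF assms(1)]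
    by (intro nonnegative_absolutely_integrable_1) auto
  have "(\<lambda>u. h u * (1 - u) powr (\<alpha> - 1)) absolutely_integrable_on {0..1}"
  proof (rule absolutely_integrable_bounded_measurable_product_real[OF _ _ _ w])
    show "h \<in> borel_measurable (lebesgue_on {0..1})"
      using assms(2) by (intro continuous_imp_measurable_on_sets_lebesgue) auto
    show "bounded (h ` {0..1})"
      using assms(2) by (intro compact_imp_bounded compact_continuous_image) auto
  qed auto
  then show ?thesis
    by (simp add: mult.commute set_lebesgue_integral_eq_integral(1))
qed

lemma abel_int_bound:
  assumes "\<alpha> > 0" and "continuous_on {0..1} h" and "\<And>u. u \<in> {0..1} \<Longrightarrow> \<bar>h u\<bar> \<le> M"
  shows "\<bar>abel_int \<alpha> h\<bar> \<le> M / \<alpha>"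
proof -
  have "norm (abel_int \<alpha> h) \<le> integral {0..1} (\<lambda>u. (1 - u) powr (\<alpha> - 1) * M)"
    unfolding abel_int_def
    using assms by (intro integral_norm_bound_integral abel_integrable continuous_on_const)
      (auto simp: abs_mult intro!: mult_left_mono)
  also have "\<dots> = 1 / \<alpha> * M"
    using has_integral_abel_weight[OF assms(1)] by (simp add: integral_unique)
  finally show ?thesis by simp
qed

lemma abel_int_diff:
  assumes "\<alpha> > 0" and "continuous_on {0..1} h" and "continuous_on {0..1} h'"
  shows "abel_int \<alpha> (\<lambda>u. h u - h' u) = abel_int \<alpha> h - abel_int \<alpha> h'"
  unfolding abel_int_def
  using abel_integrable[OF assms(1,2)] abel_integrable[OF assms(1,3)]
  by (simp add: right_diff_distrib Henstock_Kurzweil_Integration.integral_diff)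

lemma abel_int_sum:
  assumes "\<alpha> > 0" and "\<And>x. x \<in> X \<Longrightarrow> continuous_on {0..1} (h x)" and "finite X"
  shows "abel_int \<alpha> (\<lambda>u. \<Sum>x\<in>X. h x u) = (\<Sum>x\<in>X. abel_int \<alpha> (h x))"
  unfolding abel_int_def using assms
  by (simp add: sum_distrib_left Henstock_Kurzweil_Integration.integral_sum abel_integrable)

lemma abel_int_cmult: "abel_int \<alpha> (\<lambda>u. c * h u) = c * abel_int \<alpha> h"
  unfolding abel_int_def by (simp add: mult.left_commute)

lemma abel_int_cong: "(\<And>u. u \<in> {0..1} \<Longrightarrow> h u = h' u) \<Longrightarrow> abel_int \<alpha> h = abel_int \<alpha> h'"
  unfolding abel_int_def by (rule integral_cong) auto

text \<open>By the M-test the finite partial sums converge uniformly, and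
  \<open>abel_int_bound\<close> makes the integral continuous for uniform convergence. Unordered
  sums allow the kernel and solution series to be multiplied and regrouped by degree later.\<close>

lemma abel_int_has_sum:
  assumes al: "\<alpha> > 0"
    and cont: "\<And>x. x \<in> X \<Longrightarrow> continuous_on {0..1} (f x)"
    and bnd: "\<And>x u. x \<in> X \<Longrightarrow> u \<in> {0..1} \<Longrightarrow> \<bar>f x u\<bar> \<le> M x"
    and M: "M summable_on X"
    and sum: "\<And>u. u \<in> {0..1} \<Longrightarrow> ((\<lambda>x. f x u) has_sum S u) X"
  shows "((\<lambda>x. abel_int \<alpha> (f x)) has_sum abel_int \<alpha> S) X"
proof -
  have ul: "uniform_limit {0..1} (\<lambda>F u. \<Sum>x\<in>F. f x u) S (finite_subsets_at_top X)"
    by (rule Weierstrass_m_test_general'[OF _ sum M]) (use bnd in auto)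
  have contF: "continuous_on {0..1} (\<lambda>u. \<Sum>x\<in>F. f x u)" if "finite F" "F \<subseteq> X" for F
    using that cont by (intro continuous_on_sum) auto
  have contS: "continuous_on {0..1} S"
    by (rule uniform_limit_theorem[OF _ ul])
      (auto intro!: eventually_finite_subsets_at_top_weakI contF)
  show ?thesis
    unfolding has_sum_def tendsto_iff
  proof (intro allI impI)
    fix e :: real assume "e > 0"
    \<comment> \<open>Division by \<open>\<alpha>\<close> in \<open>abel_int_bound\<close> turns
      this error into \<open>e / 2\<close>, which is strictly below \<open>e\<close>.\<close>
    then have "e * \<alpha> / 2 > 0" using al by simp
    note ev = uniform_limitD[OF ul this]
    have "\<forall>\<^sub>F F in finite_subsets_at_top X. finite F \<and> F \<subseteq> X"
      by (intro eventually_finite_subsets_at_top_weakI) auto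
    from eventually_conj[OF this ev]
    have "\<forall>\<^sub>F F in finite_subsets_at_top X. (finite F \<and> F \<subseteq> X) \<and>
      (\<forall>u\<in>{0..1}. dist (\<Sum>x\<in>F. f x u) (S u) < e * \<alpha> / 2)"
      .
    then show "\<forall>\<^sub>F F in finite_subsets_at_top X. dist (\<Sum>x\<in>F. abel_int \<alpha> (f x)) (abel_int \<alpha> S) < e"
    proof (rule eventually_mono)
      fix F assume F: "(finite F \<and> F \<subseteq> X) \<and> (\<forall>u\<in>{0..1}. dist (\<Sum>x\<in>F. f x u) (S u) < e * \<alpha> / 2)"
      then have "(\<Sum>x\<in>F. abel_int \<alpha> (f x)) - abel_int \<alpha> S = abel_int \<alpha> (\<lambda>u. (\<Sum>x\<in>F. f x u) - S u)"
        using cont al contF contS by (subst abel_int_diff, (auto)[3]) (subst abel_int_sum, auto)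
      moreover have "\<bar>abel_int \<alpha> (\<lambda>u. (\<Sum>x\<in>F. f x u) - S u)\<bar> \<le> (e * \<alpha> / 2) / \<alpha>"
        using F al contF contS
        by (intro abel_int_bound continuous_on_diff) (auto simp: dist_real_def less_imp_le)
      ultimately show "dist (\<Sum>x\<in>F. abel_int \<alpha> (f x)) (abel_int \<alpha> S) < e"
        using \<open>e > 0\<close> al by (simp add: dist_real_def)
    qed
  qed
qed

text \<open>Substitution \<open>s = t * u\<close>: the weight yields
  \<open>t powr (\<alpha> - 1)\<close> and the differential one more factor \<open>t\<close>. At
  \<open>t = 0\<close>, where the substitution degenerates, both sides are \<open>0\<close>.\<close>

lemma integral_abel_stretch:
  assumes "t \<ge> 0" and "\<alpha> > 0"
  shows "integral {0..t} (\<lambda>s. (t - s) powr (\<alpha> - 1) * f s) = t powr \<alpha> * abel_int \<alpha> (\<lambda>u. f (t * u))"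
proof (cases "t = 0")
  case False
  with assms have t: "t > 0" by simp
  have "integral {0..1} (\<lambda>u. (t - t * u) powr (\<alpha> - 1) * f (t * u))
      = (1 / t) * integral {0..t} (\<lambda>s. (t - s) powr (\<alpha> - 1) * f s)"
    using integral_stretch_real[of t 0 t "\<lambda>s. (t - s) powr (\<alpha> - 1) * f s"] t by simp
  moreover have "integral {0..1} (\<lambda>u. (t - t * u) powr (\<alpha> - 1) * f (t * u))
      = integral {0..1} (\<lambda>u. t powr (\<alpha> - 1) * ((1 - u) powr (\<alpha> - 1) * f (t * u)))"
  proof (rule integral_cong)
    fix u :: real assume "u \<in> {0..1}"
    then have "(t * (1 - u)) powr (\<alpha> - 1) = t powr (\<alpha> - 1) * (1 - u) powr (\<alpha> - 1)"
      using t by (simp add: powr_mult)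
    then show "(t - t * u) powr (\<alpha> - 1) * f (t * u) = t powr (\<alpha> - 1) * ((1 - u) powr (\<alpha> - 1) * f (t * u))"
      by (simp add: right_diff_distrib)
  qed
  moreover have "\<dots> = t powr (\<alpha> - 1) * abel_int \<alpha> (\<lambda>u. f (t * u))"
    by (simp add: abel_int_def)
  ultimately have "(1 / t) * integral {0..t} (\<lambda>s. (t - s) powr (\<alpha> - 1) * f s)
      = t powr (\<alpha> - 1) * abel_int \<alpha> (\<lambda>u. f (t * u))"
    by metis
  then have "t * (1 / t * integral {0..t} (\<lambda>s. (t - s) powr (\<alpha> - 1) * f s))
      = t * (t powr (\<alpha> - 1) * abel_int \<alpha> (\<lambda>u. f (t * u)))"
    by (rule arg_cong)
  then have "integral {0..t} (\<lambda>s. (t - s) powr (\<alpha> - 1) * f s)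
      = t * t powr (\<alpha> - 1) * abel_int \<alpha> (\<lambda>u. f (t * u))"
    using t by simp
  moreover have "t * t powr (\<alpha> - 1) = t powr \<alpha>"
    using t by (simp add: powr_diff)
  ultimately show ?thesis by simp
qed simp

section \<open>Products and regrouping of unordered sums\<close>

text \<open>Real summability is absolute, so the product family is summable over pairs, and its
  value is found by summing iteratively.\<close>

lemma has_sum_product_real:
  fixes f :: "'a \<Rightarrow> real" and g :: "'b \<Rightarrow> real"
  assumes f: "(f has_sum S) A" and g: "(g has_sum T) B"
  shows "((\<lambda>(x, y). f x * g y) has_sum S * T) (A \<times> B)"
proof (rule has_sum_SigmaI)
  show "((\<lambda>y. case (x, y) of (x, y) \<Rightarrow> f x * g y) has_sum f x * T) B" for x
    using has_sum_cmult_right[OF g] by simp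
  show "((\<lambda>x. f x * T) has_sum S * T) A"
    by (rule has_sum_cmult_left[OF f])
  have fa: "(\<lambda>x. norm (f x)) summable_on A" and ga: "(\<lambda>y. norm (g y)) summable_on B"
    using f g summable_on_iff_abs_summable_on_real has_sum_imp_summable by blast+
  have "(\<lambda>z. norm (case z of (x, y) \<Rightarrow> f x * g y)) summable_on A \<times> B"
    using fa ga by (subst Infinite_Sum.abs_summable_on_Sigma_iff)
      (auto simp: abs_mult infsum_cmult_right' intro!: summable_on_cmult_right summable_on_cmult_left)
  then show "(\<lambda>(x, y). f x * g y) summable_on A \<times> B"
    by (rule abs_summable_summable)
qed

text \<open>This collects all terms of equal degree into one coefficient. The pairs
  \<open>(h x, x)\<close> reindex the original sum and split it into the fibres of
  \<open>h\<close>.\<close>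

lemma has_sum_group:
  fixes f :: "'a \<Rightarrow> real"
  assumes "(f has_sum S) UNIV" and "\<And>m. finite {x. h x = m}"
  shows "((\<lambda>m. \<Sum>x | h x = m. f x) has_sum S) UNIV"
proof (rule has_sum_SigmaD[where f = "\<lambda>(m, x). f x" and B = "\<lambda>m. {x. h x = m}"])
  show "((\<lambda>(m, x). f x) has_sum S) (SIGMA m:UNIV. {x. h x = m})"
    using assms(1)
    by (subst has_sum_reindex_bij_witness[where i = "\<lambda>x. (h x, x)" and j = snd and h = f and T = UNIV and s' = S]) auto
qed (use assms(2) in simp)

section \<open>The recursion for the coefficients and estimates of its terms\<close>

text \<open>\<open>G\<close> and \<open>c\<close> are the Taylor coefficients of the data in
  \<open>z = root \<gamma> t\<close>, and \<open>\<nu> i j\<close> will be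
  \<open>\<alpha> i j * \<gamma>\<close>. In \<open>small\<close>, the factor \<open>\<rho>\<close>
  bounds \<open>z ^ \<nu> i j\<close>, the inner sum bounds the kernel, and
  \<open>1 / \<alpha> i j\<close> is the mass of the weight; together they give the contraction by
  \<open>1 / 2\<close>.\<close>

locale abel_system =
  fixes n \<gamma> :: nat and \<nu> :: "nat \<Rightarrow> nat \<Rightarrow> nat" and \<alpha> :: "nat \<Rightarrow> nat \<Rightarrow> real"
    and G :: "nat \<Rightarrow> nat \<Rightarrow> real" and c :: "nat \<Rightarrow> nat \<Rightarrow> nat \<times> nat \<Rightarrow> real" and \<rho> :: real
  assumes gamma: "\<gamma> > 0"
    and nu: "\<And>i j. i \<in> {1..n} \<Longrightarrow> j \<in> {1..n} \<Longrightarrow> \<nu> i j \<ge> 1"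
    and alpha: "\<And>i j. i \<in> {1..n} \<Longrightarrow> j \<in> {1..n} \<Longrightarrow> \<alpha> i j > 0"
    and rho: "0 < \<rho>" "\<rho> \<le> 1"
    and G_summable: "\<And>i. i \<in> {1..n} \<Longrightarrow> summable (\<lambda>\<mu>. \<bar>G i \<mu>\<bar> * \<rho> ^ \<mu>)"
    and c_summable: "\<And>i j. i \<in> {1..n} \<Longrightarrow> j \<in> {1..n} \<Longrightarrow>
      (\<lambda>x. \<bar>c i j x\<bar> * \<rho> ^ fst x * \<rho> ^ snd x) summable_on UNIV"
    and small: "\<rho> * (\<Sum>i=1..n. \<Sum>j=1..n.
      (\<Sum>\<^sub>\<infinity>x. \<bar>c i j x\<bar> * \<rho> ^ fst x * \<rho> ^ snd x) / \<alpha> i j) \<le> 1 / 2"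
begin

text \<open>A weighted l1 norm of the kernel coefficients; it dominates the kernel itself for
  arguments in \<open>{0..\<rho>}\<close>.\<close>

definition A :: "nat \<Rightarrow> nat \<Rightarrow> real" where
  "A i j = (\<Sum>\<^sub>\<infinity>x. \<bar>c i j x\<bar> * \<rho> ^ fst x * \<rho> ^ snd x)"

lemma A_nonneg: "A i j \<ge> 0"
  unfolding A_def using rho by (intro infsum_nonneg) auto

text \<open>This is the Beta value \<open>B(\<alpha> i j, l / \<gamma> + 1)\<close>; only its boundedness in \<open>l\<close> matters.\<close>

definition moment :: "nat \<Rightarrow> nat \<Rightarrow> nat \<Rightarrow> real" where
  "moment i j l = abel_int (\<alpha> i j) (\<lambda>u. root \<gamma> u ^ l)"

lemma continuous_root_power: "continuous_on S (\<lambda>u. root \<gamma> u ^ l)"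
  by (intro continuous_intros)

lemma root_unit: "u \<in> {0..1} \<Longrightarrow> root \<gamma> u \<in> {0..1}"
  using gamma by auto

lemma moment_bound:
  assumes "i \<in> {1..n}" "j \<in> {1..n}"
  shows "\<bar>moment i j l\<bar> \<le> 1 / \<alpha> i j"
  unfolding moment_def
  using alpha[OF assms] root_unit
  by (intro abel_int_bound continuous_root_power) (auto simp: power_le_one)

text \<open>An index \<open>x = ((p, q), m)\<close> stands for the product of the term \<open>z ^ p * w ^ q\<close> of the kernel
  with the term \<open>w ^ m\<close> of the solution. The condition \<open>snd x < \<mu>\<close> follows from \<open>\<nu> i j \<ge> 1\<close> and
  is stated only because \<open>i\<close> and \<open>j\<close> are unrestricted in the termination proof.\<close>

function ycoeff :: "nat \<Rightarrow> nat \<Rightarrow> real" where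
  "ycoeff \<mu> i = G i \<mu> + (\<Sum>j=1..n.
     \<Sum>x | snd x < \<mu> \<and> fst (fst x) + snd (fst x) + snd x + \<nu> i j = \<mu>.
       c i j (fst x) * moment i j (snd (fst x) + snd x) * ycoeff (snd x) j)"
  by auto
termination by (relation "Wellfounded.measure fst") auto

declare ycoeff.simps [simp del]

text \<open>The power of \<open>z\<close> that the index \<open>x\<close> produces: three exponents
  come from the series, and \<open>\<nu> i j\<close> from the factor in front of the
  integral.\<close>

definition deg :: "nat \<Rightarrow> nat \<Rightarrow> (nat \<times> nat) \<times> nat \<Rightarrow> nat" where
  "deg i j x = fst (fst x) + snd (fst x) + snd x + \<nu> i j"

text \<open>The moment has index \<open>q + m\<close> because only the powers of \<open>w\<close>
  carry \<open>root \<gamma> u\<close>.\<close>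

definition trm :: "nat \<Rightarrow> nat \<Rightarrow> (nat \<times> nat) \<times> nat \<Rightarrow> real" where
  "trm i j x = c i j (fst x) * moment i j (snd (fst x) + snd x) * ycoeff (snd x) j"

lemma deg_le_subset: "{x. deg i j x \<le> N} \<subseteq> ({..N} \<times> {..N}) \<times> {..N}"
  by (auto simp: deg_def)

lemma finite_deg_le: "finite {x. deg i j x \<le> N}"
  by (rule finite_subset[OF deg_le_subset]) auto

lemma finite_deg_eq: "finite {x. deg i j x = \<mu>}"
  by (rule finite_subset[OF _ finite_deg_le[of i j \<mu>]]) auto

lemma ycoeff_rec:
  assumes "i \<in> {1..n}"
  shows "ycoeff \<mu> i = G i \<mu> + (\<Sum>j=1..n. \<Sum>x | deg i j x = \<mu>. trm i j x)"
proof -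
  have "{x. snd x < \<mu> \<and> fst (fst x) + snd (fst x) + snd x + \<nu> i j = \<mu>} = {x. deg i j x = \<mu>}"
    if "j \<in> {1..n}" for j
    using nu[OF assms that] by (auto simp: deg_def)
  then show ?thesis
    by (subst ycoeff.simps) (simp add: trm_def)
qed

text \<open>The moment costs at most \<open>1 / \<alpha> i j\<close>, and
  \<open>\<rho> ^ \<nu> i j \<le> \<rho>\<close> gains the one factor \<open>\<rho>\<close> on which
  the contraction rests.\<close>

lemma trm_bound:
  assumes "i \<in> {1..n}" "j \<in> {1..n}"
  shows "\<bar>trm i j x\<bar> * \<rho> ^ deg i j x \<le>
    \<rho> / \<alpha> i j * ((\<bar>c i j (fst x)\<bar> * \<rho> ^ fst (fst x) * \<rho> ^ snd (fst x)) * (\<bar>ycoeff (snd x) j\<bar> * \<rho> ^ snd x))"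
proof -
  have "\<rho> ^ \<nu> i j \<le> \<rho> ^ 1"
    using rho nu[OF assms] by (intro power_decreasing) auto
  then have "\<bar>moment i j (snd (fst x) + snd x)\<bar> * \<rho> ^ \<nu> i j \<le> 1 / \<alpha> i j * \<rho>"
    using moment_bound[OF assms] alpha[OF assms] rho by (intro mult_mono) auto
  then have "((\<bar>c i j (fst x)\<bar> * \<rho> ^ fst (fst x) * \<rho> ^ snd (fst x)) * (\<bar>ycoeff (snd x) j\<bar> * \<rho> ^ snd x)) *
      (\<bar>moment i j (snd (fst x) + snd x)\<bar> * \<rho> ^ \<nu> i j) \<le>
      ((\<bar>c i j (fst x)\<bar> * \<rho> ^ fst (fst x) * \<rho> ^ snd (fst x)) * (\<bar>ycoeff (snd x) j\<bar> * \<rho> ^ snd x)) * (1 / \<alpha> i j * \<rho>)"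
    using rho by (intro mult_left_mono) auto
  then show ?thesis
    by (simp add: trm_def deg_def power_add abs_mult ac_simps)
qed

text \<open>Degree at most \<open>N\<close> forces every exponent to be at most \<open>N\<close>;
  over the resulting cube the sum factors into a kernel part and a solution part. The same
  \<open>N\<close> bounds both sides, so the estimate can be fed into itself before convergence is
  known.\<close>

lemma trm_sum_bound:
  assumes "i \<in> {1..n}" "j \<in> {1..n}"
  shows "(\<Sum>\<mu>\<le>N. \<Sum>x | deg i j x = \<mu>. \<bar>trm i j x\<bar> * \<rho> ^ \<mu>) \<le>
    \<rho> / \<alpha> i j * A i j * (\<Sum>m\<le>N. \<bar>ycoeff m j\<bar> * \<rho> ^ m)"
proof -
  define C where "C x = \<bar>c i j x\<bar> * \<rho> ^ fst x * \<rho> ^ snd x" for x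
  define Z where "Z m = \<bar>ycoeff m j\<bar> * \<rho> ^ m" for m
  have nn: "C x \<ge> 0" "Z m \<ge> 0" for x m
    using rho by (auto simp: C_def Z_def)
  \<comment> \<open>With \<open>\<rho> ^ \<mu>\<close> written as a power to the degree, the terms
    no longer mention \<open>\<mu>\<close>, and the grouping by degree can be undone.\<close>
  have "(\<Sum>\<mu>\<le>N. \<Sum>x | deg i j x = \<mu>. \<bar>trm i j x\<bar> * \<rho> ^ \<mu>) =
      (\<Sum>\<mu>\<le>N. \<Sum>x | x \<in> {x. deg i j x \<le> N} \<and> deg i j x = \<mu>. \<bar>trm i j x\<bar> * \<rho> ^ deg i j x)"
    by (intro sum.cong) auto
  also have "\<dots> = (\<Sum>x | deg i j x \<le> N. \<bar>trm i j x\<bar> * \<rho> ^ deg i j x)"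
    by (rule sum.group) (auto simp: finite_deg_le)
  also have "\<dots> \<le> (\<Sum>x\<in>({..N} \<times> {..N}) \<times> {..N}. \<bar>trm i j x\<bar> * \<rho> ^ deg i j x)"
    using rho by (intro sum_mono2 deg_le_subset) auto
  also have "\<dots> \<le> (\<Sum>x\<in>({..N} \<times> {..N}) \<times> {..N}. \<rho> / \<alpha> i j * (C (fst x) * Z (snd x)))"
    using trm_bound[OF assms] by (intro sum_mono) (auto simp: C_def Z_def)
  also have "\<dots> = \<rho> / \<alpha> i j * ((\<Sum>x\<in>{..N} \<times> {..N}. C x) * (\<Sum>m\<le>N. Z m))"
    by (subst sum_product, subst sum.cartesian_product)
      (simp add: case_prod_beta' sum_distrib_left)
  also have "\<dots> \<le> \<rho> / \<alpha> i j * (A i j * (\<Sum>m\<le>N. Z m))"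
  proof -
    have "(\<Sum>x\<in>{..N} \<times> {..N}. C x) \<le> A i j"
      unfolding A_def C_def using c_summable[OF assms] rho
      by (intro finite_sum_le_infsum) auto
    then show ?thesis
      using rho alpha[OF assms] nn by (intro mult_left_mono mult_right_mono sum_nonneg) auto
  qed
  finally show ?thesis by (simp add: Z_def)
qed

section \<open>Convergence of the series\<close>

text \<open>The weighted partial sums satisfy a linear inequality in themselves with total factor at
  most \<open>1 / 2\<close>, so they are bounded independently of \<open>N\<close>.\<close>

lemma ycoeff_summable:
  assumes "i \<in> {1..n}"
  shows "summable (\<lambda>\<mu>. \<bar>ycoeff \<mu> i\<bar> * \<rho> ^ \<mu>)"
proof -
  define s where "s i N = (\<Sum>\<mu>\<le>N. \<bar>ycoeff \<mu> i\<bar> * \<rho> ^ \<mu>)" for i N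
  define Gs where "Gs i = (\<Sum>\<mu>. \<bar>G i \<mu>\<bar> * \<rho> ^ \<mu>)" for i
  have s0: "s i N \<ge> 0" for i N
    unfolding s_def using rho by (intro sum_nonneg) auto
  have step: "s i N \<le> Gs i + (\<Sum>j=1..n. \<rho> / \<alpha> i j * A i j * s j N)" if i: "i \<in> {1..n}" for i N
  proof -
    have "\<bar>ycoeff \<mu> i\<bar> * \<rho> ^ \<mu> \<le> \<bar>G i \<mu>\<bar> * \<rho> ^ \<mu> + (\<Sum>j=1..n. \<Sum>x | deg i j x = \<mu>. \<bar>trm i j x\<bar> * \<rho> ^ \<mu>)" for \<mu>
    proof -
      have "\<bar>ycoeff \<mu> i\<bar> \<le> \<bar>G i \<mu>\<bar> + \<bar>\<Sum>j=1..n. \<Sum>x | deg i j x = \<mu>. trm i j x\<bar>"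
        unfolding ycoeff_rec[OF i] by (rule abs_triangle_ineq)
      also have "\<dots> \<le> \<bar>G i \<mu>\<bar> + (\<Sum>j=1..n. \<Sum>x | deg i j x = \<mu>. \<bar>trm i j x\<bar>)"
        by (intro add_left_mono order.trans[OF sum_abs] sum_mono) auto
      finally have "\<bar>ycoeff \<mu> i\<bar> * \<rho> ^ \<mu> \<le> (\<bar>G i \<mu>\<bar> + (\<Sum>j=1..n. \<Sum>x | deg i j x = \<mu>. \<bar>trm i j x\<bar>)) * \<rho> ^ \<mu>"
        using rho by (intro mult_right_mono) auto
      then show ?thesis
        by (simp add: distrib_right sum_distrib_right)
    qed
    then have "s i N \<le> (\<Sum>\<mu>\<le>N. \<bar>G i \<mu>\<bar> * \<rho> ^ \<mu> + (\<Sum>j=1..n. \<Sum>x | deg i j x = \<mu>. \<bar>trm i j x\<bar> * \<rho> ^ \<mu>))"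
      unfolding s_def by (intro sum_mono)
    also have "\<dots> = (\<Sum>\<mu>\<le>N. \<bar>G i \<mu>\<bar> * \<rho> ^ \<mu>) + (\<Sum>j=1..n. \<Sum>\<mu>\<le>N. \<Sum>x | deg i j x = \<mu>. \<bar>trm i j x\<bar> * \<rho> ^ \<mu>)"
      by (simp add: sum.distrib) (rule sum.swap)
    also have "\<dots> \<le> Gs i + (\<Sum>j=1..n. \<rho> / \<alpha> i j * A i j * s j N)"
      unfolding Gs_def s_def using rho G_summable[OF i] trm_sum_bound[OF i]
      by (intro add_mono sum_mono sum_le_suminf) auto
    finally show ?thesis .
  qed
  \<comment> \<open>Replacing each \<open>s j N\<close> by the total \<open>S\<close> makes the
    double sum of \<open>small\<close> appear. As \<open>S\<close> is finite, \<open>S / 2\<close>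
    can be absorbed on the left, whence the factor \<open>2\<close>.\<close>
  have bound: "(\<Sum>i=1..n. s i N) \<le> 2 * (\<Sum>i=1..n. Gs i)" for N
  proof -
    define S where "S = (\<Sum>i=1..n. s i N)"
    have S0: "S \<ge> 0"
      unfolding S_def by (intro sum_nonneg s0)
    have sS: "s j N \<le> S" if "j \<in> {1..n}" for j
      unfolding S_def using s0 that by (intro member_le_sum) auto
    have "S \<le> (\<Sum>i=1..n. Gs i + (\<Sum>j=1..n. \<rho> / \<alpha> i j * A i j * s j N))"
      unfolding S_def by (intro sum_mono step)
    also have "\<dots> \<le> (\<Sum>i=1..n. Gs i + (\<Sum>j=1..n. \<rho> / \<alpha> i j * A i j * S))"
      by (intro sum_mono add_left_mono mult_left_mono sS mult_nonneg_nonneg divide_nonneg_pos A_nonneg alpha)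
        (use rho in auto)
    also have "\<dots> = (\<Sum>i=1..n. Gs i) + \<rho> * (\<Sum>i=1..n. \<Sum>j=1..n. A i j / \<alpha> i j) * S"
      by (simp add: sum.distrib sum_distrib_left sum_distrib_right mult.assoc)
    also have "\<dots> \<le> (\<Sum>i=1..n. Gs i) + 1 / 2 * S"
      using small S0 unfolding A_def by (intro add_left_mono mult_right_mono) auto
    finally show ?thesis by (simp add: S_def)
  qed
  have "s i N \<le> 2 * (\<Sum>i=1..n. Gs i)" for N
    using member_le_sum[of i "{1..n}" "\<lambda>i. s i N"] assms s0 bound[of N] by simp
  then have "(\<Sum>\<mu><N. \<bar>ycoeff \<mu> i\<bar> * \<rho> ^ \<mu>) \<le> 2 * (\<Sum>i=1..n. Gs i)" for N
    using rho unfolding s_def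
    by (intro order.trans[OF sum_mono2[of "{..N}" "{..<N}"]]) auto
  then show ?thesis
    using rho by (intro summableI_nonneg_bounded) auto
qed

section \<open>The sum of the series and the kernel as functions of the root variable\<close>

text \<open>The argument stands for \<open>root \<gamma> t\<close>, which makes this an ordinary
  power series.\<close>

definition Y :: "nat \<Rightarrow> real \<Rightarrow> real" where
  "Y i x = (\<Sum>\<mu>. ycoeff \<mu> i * x ^ \<mu>)"

lemma Y_abs_summable:
  assumes "i \<in> {1..n}" "\<bar>x\<bar> \<le> \<rho>"
  shows "summable (\<lambda>\<mu>. norm (ycoeff \<mu> i * x ^ \<mu>))"
  using ycoeff_summable[OF assms(1)]
  by (rule summable_comparison_test')
    (use assms in \<open>auto simp: abs_mult power_abs intro!: mult_left_mono power_mono\<close>)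

lemma Y_sums:
  assumes "i \<in> {1..n}" "\<bar>x\<bar> \<le> \<rho>"
  shows "(\<lambda>\<mu>. ycoeff \<mu> i * x ^ \<mu>) sums Y i x"
  unfolding Y_def by (intro summable_sums summable_norm_cancel[OF Y_abs_summable[OF assms]])

text \<open>Weighted summability at \<open>\<rho>\<close> gives uniform convergence up to and
  including that endpoint.\<close>

lemma Y_continuous:
  assumes "i \<in> {1..n}"
  shows "continuous_on {0..\<rho>} (Y i)"
  unfolding Y_def
proof (rule uniform_limit_theorem[OF _ Weierstrass_m_test[OF _ ycoeff_summable[OF assms]]])
  show "norm (ycoeff \<mu> i * x ^ \<mu>) \<le> \<bar>ycoeff \<mu> i\<bar> * \<rho> ^ \<mu>" if "x \<in> {0..\<rho>}" for \<mu> x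
    using that by (auto simp: abs_mult intro!: mult_left_mono power_mono)
qed (auto intro!: always_eventually continuous_intros)

definition kern :: "nat \<Rightarrow> nat \<Rightarrow> real \<Rightarrow> real \<Rightarrow> real" where
  "kern i j z w = (\<Sum>\<^sub>\<infinity>x. c i j x * z ^ fst x * w ^ snd x)"

lemma kern_term_bound:
  assumes "0 \<le> z" "z \<le> \<rho>" "0 \<le> w" "w \<le> \<rho>"
  shows "\<bar>c i j x * z ^ fst x * w ^ snd x\<bar> \<le> \<bar>c i j x\<bar> * \<rho> ^ fst x * \<rho> ^ snd x"
  using assms by (auto simp: abs_mult intro!: mult_mono power_mono)

lemma kern_abs_summable:
  assumes "i \<in> {1..n}" "j \<in> {1..n}" "0 \<le> z" "z \<le> \<rho>" "0 \<le> w" "w \<le> \<rho>"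
  shows "(\<lambda>x. norm (c i j x * z ^ fst x * w ^ snd x)) summable_on UNIV"
  using c_summable[OF assms(1,2)]
  by (rule Infinite_Sum.abs_summable_on_comparison_test') (use kern_term_bound[OF assms(3-6)] in simp)

lemma kern_has_sum:
  assumes "i \<in> {1..n}" "j \<in> {1..n}" "0 \<le> z" "z \<le> \<rho>" "0 \<le> w" "w \<le> \<rho>"
  shows "((\<lambda>x. c i j x * z ^ fst x * w ^ snd x) has_sum kern i j z w) UNIV"
  unfolding kern_def
  by (rule has_sum_infsum, subst summable_on_iff_abs_summable_on_real) (rule kern_abs_summable[OF assms])

lemma kern_bound:
  assumes "i \<in> {1..n}" "j \<in> {1..n}" "0 \<le> z" "z \<le> \<rho>" "0 \<le> w" "w \<le> \<rho>"
  shows "\<bar>kern i j z w\<bar> \<le> A i j"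
proof -
  have "norm (kern i j z w) \<le> (\<Sum>\<^sub>\<infinity>x. norm (c i j x * z ^ fst x * w ^ snd x))"
    unfolding kern_def by (rule norm_infsum_bound[OF kern_abs_summable[OF assms]])
  also have "\<dots> \<le> A i j"
    unfolding A_def
    by (rule infsum_mono[OF kern_abs_summable[OF assms] c_summable[OF assms(1,2)]])
      (use kern_term_bound[OF assms(3-6)] in simp)
  finally show ?thesis by simp
qed

section \<open>The series solves the transformed system\<close>

text \<open>The product of the kernel and solution series is dominated uniformly in \<open>u\<close>
  by a summable product family, so it can be integrated term by term; each term leaves a
  moment.\<close>

lemma integral_term_has_sum:
  assumes i: "i \<in> {1..n}" and j: "j \<in> {1..n}" and z: "0 \<le> z" "z \<le> \<rho>"
  shows "((\<lambda>x. trm i j x * z ^ deg i j x) has_sum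
    z ^ \<nu> i j * abel_int (\<alpha> i j) (\<lambda>u. kern i j z (z * root \<gamma> u) * Y j (z * root \<gamma> u))) UNIV"
proof -
  \<comment> \<open>This form isolates the power of \<open>root \<gamma> u\<close>, so that the
    constant can be taken out of the integral; \<open>f_alt\<close> groups the same product as
    kernel term times solution term.\<close>
  define f where "f x u = c i j (fst x) * z ^ fst (fst x) * ycoeff (snd x) j *
    z ^ (snd (fst x) + snd x) * root \<gamma> u ^ (snd (fst x) + snd x)" for x :: "(nat \<times> nat) \<times> nat" and u
  define C where "C x = \<bar>c i j x\<bar> * \<rho> ^ fst x * \<rho> ^ snd x" for x
  define Z where "Z m = \<bar>ycoeff m j\<bar> * \<rho> ^ m" for m
  have w: "0 \<le> z * root \<gamma> u \<and> z * root \<gamma> u \<le> \<rho>" if "u \<in> {0..1}" for u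
    using mult_mono[of z \<rho> "root \<gamma> u" 1] root_unit[OF that] z by auto
  have f_alt: "f x u = (c i j (fst x) * z ^ fst (fst x) * (z * root \<gamma> u) ^ snd (fst x)) *
      (ycoeff (snd x) j * (z * root \<gamma> u) ^ snd x)" for x u
    unfolding f_def power_add power_mult_distrib by (simp only: ac_simps)
  have "((\<lambda>x. abel_int (\<alpha> i j) (f x)) has_sum
      abel_int (\<alpha> i j) (\<lambda>u. kern i j z (z * root \<gamma> u) * Y j (z * root \<gamma> u))) UNIV"
  proof (rule abel_int_has_sum[OF alpha[OF i j], where M = "\<lambda>x. C (fst x) * Z (snd x)"])
    show "continuous_on {0..1} (f x)" for x
      unfolding f_def by (intro continuous_intros)
    show "\<bar>f x u\<bar> \<le> C (fst x) * Z (snd x)" if "u \<in> {0..1}" for x u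
    proof -
      have "\<bar>ycoeff (snd x) j * (z * root \<gamma> u) ^ snd x\<bar> \<le> Z (snd x)"
        using w[OF that] by (auto simp: Z_def abs_mult intro!: mult_left_mono power_mono)
      moreover have "\<bar>c i j (fst x) * z ^ fst (fst x) * (z * root \<gamma> u) ^ snd (fst x)\<bar> \<le> C (fst x)"
        unfolding C_def using w[OF that] z by (intro kern_term_bound) auto
      ultimately show ?thesis
        unfolding f_alt abs_mult[of "_ * _ * _" "_ * _"]
          by (intro mult_mono) (use rho in \<open>auto simp: C_def\<close>)
    qed
    have "(Z has_sum (\<Sum>m. Z m)) UNIV"
      using ycoeff_summable[OF j] rho unfolding Z_def
      by (intro sums_nonneg_imp_has_sum summable_sums) auto
    moreover have "(C has_sum A i j) UNIV"
      unfolding C_def A_def by (intro has_sum_infsum c_summable i j)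
    ultimately have "((\<lambda>(x, m). C x * Z m) has_sum A i j * (\<Sum>m. Z m)) (UNIV \<times> UNIV)"
      by (intro has_sum_product_real)
    then show "(\<lambda>x. C (fst x) * Z (snd x)) summable_on UNIV"
      unfolding case_prod_beta' UNIV_Times_UNIV by (rule has_sum_imp_summable)
    show "((\<lambda>x. f x u) has_sum kern i j z (z * root \<gamma> u) * Y j (z * root \<gamma> u)) UNIV"
      if u: "u \<in> {0..1}" for u
    proof -
      have "((\<lambda>m. ycoeff m j * (z * root \<gamma> u) ^ m) has_sum Y j (z * root \<gamma> u)) UNIV"
        using w[OF u] by (intro norm_summable_imp_has_sum Y_abs_summable Y_sums j) auto
      moreover have "((\<lambda>x. c i j x * z ^ fst x * (z * root \<gamma> u) ^ snd x) has_sum kern i j z (z * root \<gamma> u)) UNIV"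
        using w[OF u] z by (intro kern_has_sum i j) auto
      ultimately have "((\<lambda>(x, m). (c i j x * z ^ fst x * (z * root \<gamma> u) ^ snd x) *
          (ycoeff m j * (z * root \<gamma> u) ^ m)) has_sum
          kern i j z (z * root \<gamma> u) * Y j (z * root \<gamma> u)) (UNIV \<times> UNIV)"
        by (intro has_sum_product_real)
      then show ?thesis
        unfolding f_alt case_prod_beta' UNIV_Times_UNIV by simp
    qed
  qed
  then have "((\<lambda>x. z ^ \<nu> i j * abel_int (\<alpha> i j) (f x)) has_sum
      z ^ \<nu> i j * abel_int (\<alpha> i j) (\<lambda>u. kern i j z (z * root \<gamma> u) * Y j (z * root \<gamma> u))) UNIV"
    by (rule has_sum_cmult_right)
  moreover have "z ^ \<nu> i j * abel_int (\<alpha> i j) (f x) = trm i j x * z ^ deg i j x" for x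
  proof -
    have "abel_int (\<alpha> i j) (f x) = c i j (fst x) * z ^ fst (fst x) * ycoeff (snd x) j *
        z ^ (snd (fst x) + snd x) * moment i j (snd (fst x) + snd x)"
      unfolding f_def moment_def by (rule abel_int_cmult)
    then show ?thesis
      by (simp add: trm_def deg_def power_add)
  qed
  ultimately show ?thesis by (simp only:)
qed

text \<open>Collecting the integrated terms by degree gives a power series in \<open>z\<close> whose
  coefficients are those of \<open>ycoeff_rec\<close>.\<close>

lemma Y_equation:
  assumes i: "i \<in> {1..n}" and z: "0 \<le> z" "z \<le> \<rho>"
  shows "Y i z = (\<Sum>\<mu>. G i \<mu> * z ^ \<mu>) + (\<Sum>j=1..n. z ^ \<nu> i j *
    abel_int (\<alpha> i j) (\<lambda>u. kern i j z (z * root \<gamma> u) * Y j (z * root \<gamma> u)))"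
proof -
  have "(\<lambda>\<mu>. \<Sum>x | deg i j x = \<mu>. trm i j x * z ^ deg i j x) sums
      (z ^ \<nu> i j * abel_int (\<alpha> i j) (\<lambda>u. kern i j z (z * root \<gamma> u) * Y j (z * root \<gamma> u)))"
    if "j \<in> {1..n}" for j
    by (intro has_sum_imp_sums has_sum_group integral_term_has_sum i that z finite_deg_eq)
  then have "(\<lambda>\<mu>. \<Sum>j=1..n. \<Sum>x | deg i j x = \<mu>. trm i j x * z ^ deg i j x) sums
      (\<Sum>j=1..n. z ^ \<nu> i j * abel_int (\<alpha> i j) (\<lambda>u. kern i j z (z * root \<gamma> u) * Y j (z * root \<gamma> u)))"
    by (intro sums_sum)
  moreover have "summable (\<lambda>\<mu>. G i \<mu> * z ^ \<mu>)"
    by (rule summable_comparison_test'[OF G_summable[OF i]])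
      (use z in \<open>auto simp: abs_mult intro!: mult_left_mono power_mono\<close>)
  ultimately have "(\<lambda>\<mu>. G i \<mu> * z ^ \<mu> + (\<Sum>j=1..n. \<Sum>x | deg i j x = \<mu>. trm i j x * z ^ deg i j x)) sums
      ((\<Sum>\<mu>. G i \<mu> * z ^ \<mu>) + (\<Sum>j=1..n. z ^ \<nu> i j *
        abel_int (\<alpha> i j) (\<lambda>u. kern i j z (z * root \<gamma> u) * Y j (z * root \<gamma> u))))"
    by (intro sums_add summable_sums)
  moreover have "G i \<mu> * z ^ \<mu> + (\<Sum>j=1..n. \<Sum>x | deg i j x = \<mu>. trm i j x * z ^ deg i j x) = ycoeff \<mu> i * z ^ \<mu>" for \<mu>
    by (simp add: ycoeff_rec[OF i] distrib_right sum_distrib_right)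
  ultimately have "(\<lambda>\<mu>. ycoeff \<mu> i * z ^ \<mu>) sums
      ((\<Sum>\<mu>. G i \<mu> * z ^ \<mu>) + (\<Sum>j=1..n. z ^ \<nu> i j *
        abel_int (\<alpha> i j) (\<lambda>u. kern i j z (z * root \<gamma> u) * Y j (z * root \<gamma> u))))"
    by (simp only:)
  moreover have "(\<lambda>\<mu>. ycoeff \<mu> i * z ^ \<mu>) sums Y i z"
    using z by (intro Y_sums i) auto
  ultimately show ?thesis
    by (rule sums_unique2[symmetric])
qed

section \<open>The homogeneous system near the origin\<close>

text \<open>This will be applied to the difference of a solution and the series. At a maximum of the
  sum of the absolute values, the equation and \<open>small\<close> bound that maximum by half of
  itself.\<close>

lemma homogeneous_solution_zero:
  fixes k :: "nat \<Rightarrow> nat \<Rightarrow> real \<times> real \<Rightarrow> real" and u :: "nat \<Rightarrow> real \<Rightarrow> real"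
  assumes \<delta>: "0 \<le> \<delta>" "\<delta> \<le> 1" "root \<gamma> \<delta> \<le> \<rho>"
    and k_cont: "\<And>i j. i \<in> {1..n} \<Longrightarrow> j \<in> {1..n} \<Longrightarrow> continuous_on triangle_D (k i j)"
    and k_bound: "\<And>i j t s. i \<in> {1..n} \<Longrightarrow> j \<in> {1..n} \<Longrightarrow> 0 \<le> s \<Longrightarrow> s \<le> t \<Longrightarrow> t \<le> \<delta> \<Longrightarrow>
      \<bar>k i j (t, s)\<bar> \<le> A i j"
    and u_cont: "\<And>i. i \<in> {1..n} \<Longrightarrow> continuous_on {0..\<delta>} (u i)"
    and u_eq: "\<And>i t. i \<in> {1..n} \<Longrightarrow> t \<in> {0..\<delta>} \<Longrightarrow> u i t = (\<Sum>j=1..n. root \<gamma> t ^ \<nu> i j *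
      abel_int (\<alpha> i j) (\<lambda>v. k i j (t, t * v) * u j (t * v)))"
    and i: "i \<in> {1..n}" and t: "t \<in> {0..\<delta>}"
  shows "u i t = 0"
proof -
  \<comment> \<open>Adding up the components lets one maximum control all of them and matches the
    double sum in \<open>small\<close>.\<close>
  define U where "U t = (\<Sum>i=1..n. \<bar>u i t\<bar>)" for t
  have "continuous_on {0..\<delta>} U"
    unfolding U_def by (intro continuous_intros u_cont)
  then obtain t0 where t0: "t0 \<in> {0..\<delta>}" and max: "\<And>t. t \<in> {0..\<delta>} \<Longrightarrow> U t \<le> U t0"
    using continuous_attains_sup[of "{0..\<delta>}" U] \<delta>(1) by auto
  have u_le: "\<bar>u j s\<bar> \<le> U t0" if "j \<in> {1..n}" "s \<in> {0..\<delta>}" for j s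
  proof -
    have "\<bar>u j s\<bar> \<le> U s"
      unfolding U_def using that by (intro member_le_sum) auto
    with max[OF that(2)] show ?thesis by simp
  qed
  have U0: "U t0 \<ge> 0"
    unfolding U_def by (intro sum_nonneg) auto
  have term_le: "\<bar>root \<gamma> t0 ^ \<nu> i j * abel_int (\<alpha> i j) (\<lambda>v. k i j (t0, t0 * v) * u j (t0 * v))\<bar>
      \<le> \<rho> * (A i j / \<alpha> i j) * U t0" if ij: "i \<in> {1..n}" "j \<in> {1..n}" for i j
  proof -
    have range: "t0 * v \<in> {0..\<delta>}" "t0 * v \<le> t0" "0 \<le> t0 * v" if "v \<in> {0..1}" for v
    proof -
      show "t0 * v \<le> t0" "0 \<le> t0 * v" using that t0 by (auto intro: mult_left_le)
      then show "t0 * v \<in> {0..\<delta>}" using t0 by auto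
    qed
    have cont: "continuous_on {0..1} (\<lambda>v. k i j (t0, t0 * v) * u j (t0 * v))"
    proof (intro continuous_on_mult)
      show "continuous_on {0..1} (\<lambda>v. k i j (t0, t0 * v))"
        by (rule continuous_on_compose2[OF k_cont[OF ij]])
          (use range t0 \<delta> in \<open>auto intro!: continuous_intros simp: triangle_D_def\<close>)
      show "continuous_on {0..1} (\<lambda>v. u j (t0 * v))"
        by (rule continuous_on_compose2[OF u_cont[OF ij(2)]])
          (use range in \<open>auto intro!: continuous_intros\<close>)
    qed
    have int: "\<bar>abel_int (\<alpha> i j) (\<lambda>v. k i j (t0, t0 * v) * u j (t0 * v))\<bar> \<le> A i j * U t0 / \<alpha> i j"
    proof (rule abel_int_bound[OF alpha[OF ij] cont])
      fix v :: real assume v: "v \<in> {0..1}"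
      show "\<bar>k i j (t0, t0 * v) * u j (t0 * v)\<bar> \<le> A i j * U t0"
        unfolding abs_mult
        using k_bound[OF ij range(3,2)[OF v]] u_le[OF ij(2) range(1)[OF v]] t0 A_nonneg
        by (intro mult_mono) auto
    qed
    have z: "0 \<le> root \<gamma> t0" "root \<gamma> t0 \<le> \<rho>"
    proof -
      show "0 \<le> root \<gamma> t0" using t0 by (auto intro: real_root_ge_zero)
      have "root \<gamma> t0 \<le> root \<gamma> \<delta>" using t0 gamma by simp
      with \<delta>(3) show "root \<gamma> t0 \<le> \<rho>" by simp
    qed
    \<comment> \<open>The base is at most \<open>\<rho> \<le> 1\<close>, so raising the exponent
      from \<open>1\<close> to \<open>\<nu> i j\<close> does not increase the power.\<close>
    then have "root \<gamma> t0 ^ \<nu> i j \<le> root \<gamma> t0 ^ 1"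
      using nu[OF ij] rho by (intro power_decreasing) auto
    then have "\<bar>root \<gamma> t0 ^ \<nu> i j\<bar> \<le> \<rho>"
      using z by simp
    then have "\<bar>root \<gamma> t0 ^ \<nu> i j * abel_int (\<alpha> i j) (\<lambda>v. k i j (t0, t0 * v) * u j (t0 * v))\<bar>
        \<le> \<rho> * (A i j * U t0 / \<alpha> i j)"
      unfolding abs_mult using int rho by (intro mult_mono) auto
    then show ?thesis by simp
  qed
  have "U t0 \<le> (\<Sum>i=1..n. \<Sum>j=1..n. \<rho> * (A i j / \<alpha> i j) * U t0)"
    unfolding U_def[of t0]
  proof (intro sum_mono)
    fix i assume i: "i \<in> {1..n}"
    have "\<bar>u i t0\<bar> \<le> (\<Sum>j=1..n. \<bar>root \<gamma> t0 ^ \<nu> i j *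
        abel_int (\<alpha> i j) (\<lambda>v. k i j (t0, t0 * v) * u j (t0 * v))\<bar>)"
      unfolding u_eq[OF i t0] by (rule sum_abs)
    also have "\<dots> \<le> (\<Sum>j=1..n. \<rho> * (A i j / \<alpha> i j) * U t0)"
      by (intro sum_mono term_le i)
    finally show "\<bar>u i t0\<bar> \<le> (\<Sum>j=1..n. \<rho> * (A i j / \<alpha> i j) * (\<Sum>i=1..n. \<bar>u i t0\<bar>))"
      unfolding U_def .
  qed
  also have "\<dots> = \<rho> * (\<Sum>i=1..n. \<Sum>j=1..n. A i j / \<alpha> i j) * U t0"
    by (simp add: sum_distrib_left sum_distrib_right)
  also have "\<dots> \<le> 1 / 2 * U t0"
    using small U0 unfolding A_def by (intro mult_right_mono) auto
  finally have "U t0 \<le> 0" by simp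
  with u_le[OF i t] show ?thesis by simp
qed

end

section \<open>Uniqueness of the coefficients and conversion of fractional powers\<close>

text \<open>In the variable \<open>x = root \<gamma> t\<close> the difference of the two series
  vanishes on \<open>{0..r}\<close>, whereas a power series with a nonzero coefficient has no zeros
  close to \<open>0\<close> other than \<open>0\<close> itself.\<close>

lemma has_fractional_series_unique:
  assumes "\<gamma> > 0" and "\<epsilon> > 0" "has_fractional_series \<gamma> f c \<epsilon>" and "\<delta> > 0" "has_fractional_series \<gamma> f d \<delta>"
  shows "c = d"
proof (rule ccontr)
  assume "c \<noteq> d"
  then obtain m where m: "c m \<noteq> d m" by blast
  define e where "e \<mu> = c \<mu> - d \<mu>" for \<mu>
  \<comment> \<open>Half of the smaller bound keeps \<open>x ^ \<gamma>\<close> inside both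
    half-open intervals for all \<open>x \<le> r\<close>.\<close>
  define r where "r = root \<gamma> (min \<epsilon> \<delta> / 2)"
  have r: "r > 0" using assms by (simp add: r_def)
  have zero: "(\<lambda>\<mu>. e \<mu> * x ^ \<mu>) sums 0" if x: "0 \<le> x" "x \<le> r" for x
  proof -
    have "x ^ \<gamma> \<le> r ^ \<gamma>" using x by (intro power_mono) auto
    also have "\<dots> = min \<epsilon> \<delta> / 2" unfolding r_def using assms by (intro real_root_pow_pos2) auto
    finally have "x ^ \<gamma> \<in> {0..<\<epsilon>}" "x ^ \<gamma> \<in> {0..<\<delta>}" using assms x by auto
    moreover have "root \<gamma> (x ^ \<gamma>) = x" using assms x by (simp add: real_root_power_cancel)
    ultimately have "(\<lambda>\<mu>. c \<mu> * x ^ \<mu>) sums f (x ^ \<gamma>)" "(\<lambda>\<mu>. d \<mu> * x ^ \<mu>) sums f (x ^ \<gamma>)"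
      using assms(3,5) unfolding has_fractional_series_def by force+
    from sums_diff[OF this] show ?thesis by (simp add: e_def left_diff_distrib)
  qed
  \<comment> \<open>The theorem on isolated zeros needs a sum vanishing at the centre and a nonzero
    coefficient of positive index; both follow from this.\<close>
  have e0: "e 0 = 0"
    using sums_unique2[OF zero[of 0] powser_sums_zero] r by simp
  \<comment> \<open>The vanishing is known for \<open>x \<ge> 0\<close>, but a two-sided expansion
    is required; convergence at \<open>r\<close> provides it.\<close>
  have sums: "(\<lambda>\<mu>. e \<mu> * (x - 0) ^ \<mu>) sums (\<Sum>\<mu>. e \<mu> * x ^ \<mu>)" if "norm (x - 0) < r" for x
    using powser_inside[OF sums_summable[OF zero[of r]], of x] that r by (simp add: summable_sums)
  have "m > 0" "e m \<noteq> 0"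
    using m e0 by (auto simp: e_def intro: gr0I)
  then obtain s where s: "s > 0" "\<And>x. x \<in> cball 0 s - {0} \<Longrightarrow> (\<Sum>\<mu>. e \<mu> * x ^ \<mu>) \<noteq> 0"
    using powser_0_nonzero[OF r sums, of m] e0 by (auto simp: powser_zero)
  \<comment> \<open>The point \<open>min s r\<close> lies both where the sum vanishes and where it
    must not.\<close>
  have "(\<Sum>\<mu>. e \<mu> * min s r ^ \<mu>) = 0"
    using zero[of "min s r"] s r by (simp add: sums_iff)
  moreover have "min s r \<in> cball 0 s - {0}" using s(1) r by auto
  ultimately show False using s(2) by blast
qed

text \<open>For \<open>t > 0\<close> this is \<open>\<alpha> = \<nu> / \<gamma>\<close> in the
  exponent; at \<open>t = 0\<close> both sides vanish, the right one because
  \<open>\<nu> > 0\<close>.\<close>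

lemma powr_rational_eq_root_power:
  fixes t :: real
  assumes "t \<ge> 0" "\<gamma> > 0" "\<nu> > 0" "\<alpha> * real \<gamma> = real \<nu>"
  shows "t powr \<alpha> = root \<gamma> t ^ \<nu>"
proof (cases "t = 0")
  case False
  with assms have t: "t > 0" by simp
  have "root \<gamma> t ^ \<nu> = (t powr (1 / real \<gamma>)) powr real \<nu>"
    using t assms by (simp add: root_powr_inverse powr_realpow)
  also have "\<dots> = t powr (real \<nu> / real \<gamma>)"
    by (simp add: powr_powr)
  also have "real \<nu> / real \<gamma> = \<alpha>"
    using assms by (simp add: field_simps)
  finally show ?thesis by simp
qed (use assms in simp)

section \<open>The series representation of the solution\<close>

text \<open>The coefficients and \<open>\<delta>\<close> are chosen before \<open>y\<close>, so they
  depend on the data alone; the last clause says that no other coefficients represent the solution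
  near \<open>0\<close>.\<close>

theorem theorem2:
  fixes n \<gamma> :: nat
    and a b :: "nat \<Rightarrow> nat \<Rightarrow> nat"
    and \<alpha> :: "nat \<Rightarrow> nat \<Rightarrow> real"
    and g gbar :: "nat \<Rightarrow> real \<Rightarrow> real"
    and k kbar :: "nat \<Rightarrow> nat \<Rightarrow> real \<times> real \<Rightarrow> real"
  assumes "n \<ge> 1"
    and "\<And>i j. i \<in> {1..n} \<Longrightarrow> j \<in> {1..n} \<Longrightarrow> a i j > 0 \<and> b i j > 0 \<and> coprime (a i j) (b i j)"
    and "\<And>i j. i \<in> {1..n} \<Longrightarrow> j \<in> {1..n} \<Longrightarrow> \<alpha> i j = real (a i j) / real (b i j)"
    and "\<And>i j. i \<in> {1..n} \<Longrightarrow> j \<in> {1..n} \<Longrightarrow> \<alpha> i j \<in> {0<..1}"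
    and "\<gamma> = Lcm {b i j | i j. i \<in> {1..n} \<and> j \<in> {1..n}}"
    and "\<And>i. i \<in> {1..n} \<Longrightarrow> continuous_on {0..1} (g i)"
    and "\<And>i j. i \<in> {1..n} \<Longrightarrow> j \<in> {1..n} \<Longrightarrow> continuous_on triangle_D (k i j)"
    and "\<And>i t. i \<in> {1..n} \<Longrightarrow> t \<in> {0..1} \<Longrightarrow> g i t = gbar i (root \<gamma> t)"
    and "\<And>i j t s. i \<in> {1..n} \<Longrightarrow> j \<in> {1..n} \<Longrightarrow> (t, s) \<in> triangle_D \<Longrightarrow>
           k i j (t, s) = kbar i j (root \<gamma> t, root \<gamma> s)"
    and "\<And>i. i \<in> {1..n} \<Longrightarrow> real_analytic_near (gbar i) 0"
    and "\<And>i j. i \<in> {1..n} \<Longrightarrow> j \<in> {1..n} \<Longrightarrow> real_analytic2_near (kbar i j) (0, 0)"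
  shows "\<exists>(ybar :: nat \<Rightarrow> nat \<Rightarrow> real) \<delta>. 0 < \<delta> \<and> \<delta> \<le> 1 \<and>
           (\<forall>y. continuous_volterra_solution n \<alpha> g k y \<longrightarrow>
              (\<forall>i\<in>{1..n}. has_fractional_series \<gamma> (y i) (ybar i) \<delta> \<and>
                 (\<forall>c \<epsilon>. 0 < \<epsilon> \<and> has_fractional_series \<gamma> (y i) c \<epsilon> \<longrightarrow> c = ybar i)))"
proof -
  let ?I = "{1..n}"
  have alpha: "\<alpha> i j > 0" if "i \<in> ?I" "j \<in> ?I" for i j
    using assms(4)[OF that] by simp
  have b_eq: "{b i j | i j. i \<in> ?I \<and> j \<in> ?I} = (\<lambda>(i, j). b i j) ` (?I \<times> ?I)"
    by force
  have gamma: "\<gamma> > 0"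
  proof -
    \<comment> \<open>An \<open>Lcm\<close> of naturals is \<open>0\<close> when \<open>0\<close>
      occurs in the set or the set is infinite, so both cases are excluded.\<close>
    have "0 \<notin> {b i j | i j. i \<in> ?I \<and> j \<in> ?I}"
      unfolding mem_Collect_eq by (metis assms(2) less_irrefl)
    moreover have "finite {b i j | i j. i \<in> ?I \<and> j \<in> ?I}"
      unfolding b_eq by auto
    ultimately have "\<gamma> \<noteq> 0"
      unfolding assms(5) by (simp add: Lcm_0_iff)
    then show ?thesis by simp
  qed
  \<comment> \<open>Each \<open>b i j\<close> divides \<open>\<gamma>\<close>, so the division is
    exact and \<open>\<nu> i j\<close> equals \<open>\<alpha> i j * \<gamma>\<close>.\<close>
  define \<nu> where "\<nu> i j = a i j * (\<gamma> div b i j)" for i j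
  have nu_alpha: "\<nu> i j \<ge> 1" "\<alpha> i j * real \<gamma> = real (\<nu> i j)" if ij: "i \<in> ?I" "j \<in> ?I" for i j
  proof -
    have dvd: "b i j dvd \<gamma>"
      unfolding assms(5) using ij by (intro dvd_Lcm) auto
    then show "\<nu> i j \<ge> 1"
      using assms(2)[OF ij] gamma by (auto simp: \<nu>_def elim!: dvdE)
    show "\<alpha> i j * real \<gamma> = real (\<nu> i j)"
      using dvd assms(2,3)[OF ij] by (auto simp: \<nu>_def elim!: dvdE)
  qed

  \<comment> \<open>Expansions of the data and choice of a common radius\<close>
  have "\<forall>i\<in>?I. \<exists>C r. r > 0 \<and> (\<forall>x. \<bar>x\<bar> < r \<longrightarrow> (\<lambda>m. C m * x ^ m) sums gbar i x)"
  proof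
    fix i assume "i \<in> ?I"
    then have "real_analytic_at (gbar i) 0"
      using assms(10) unfolding real_analytic_near_def by blast
    then show "\<exists>C r. r > 0 \<and> (\<forall>x. \<bar>x\<bar> < r \<longrightarrow> (\<lambda>m. C m * x ^ m) sums gbar i x)"
      unfolding real_analytic_at_def by simp
  qed
  then obtain G rG where G: "\<And>i. i \<in> ?I \<Longrightarrow> rG i > 0"
      "\<And>i x. i \<in> ?I \<Longrightarrow> \<bar>x\<bar> < rG i \<Longrightarrow> (\<lambda>m. G i m * x ^ m) sums gbar i x"
    by metis
  have "\<forall>p\<in>?I \<times> ?I. \<exists>C r. r > 0 \<and> (\<forall>x y. \<bar>x\<bar> < r \<and> \<bar>y\<bar> < r \<longrightarrow>
      ((\<lambda>q. C q * x ^ fst q * y ^ snd q) has_sum kbar (fst p) (snd p) (x, y)) UNIV)"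
  proof
    fix p assume "p \<in> ?I \<times> ?I"
    then have "real_analytic2_at (kbar (fst p) (snd p)) (0, 0)"
      using assms(11)[of "fst p" "snd p"] unfolding real_analytic2_near_def by auto
    then obtain C r where "r > 0" "\<And>x y. \<bar>x\<bar> < r \<and> \<bar>y\<bar> < r \<Longrightarrow>
        ((\<lambda>(l, m). C l m * x ^ l * y ^ m) has_sum kbar (fst p) (snd p) (x, y)) UNIV"
      unfolding real_analytic2_at_def by auto
    then show "\<exists>C r. r > 0 \<and> (\<forall>x y. \<bar>x\<bar> < r \<and> \<bar>y\<bar> < r \<longrightarrow>
      ((\<lambda>q. C q * x ^ fst q * y ^ snd q) has_sum kbar (fst p) (snd p) (x, y)) UNIV)"
      by (intro exI[of _ "\<lambda>q. C (fst q) (snd q)"] exI[of _ r]) (auto simp: case_prod_beta')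
  qed
  from bchoice[OF this] obtain c' where "\<forall>p\<in>?I \<times> ?I. \<exists>r. r > 0 \<and> (\<forall>x y. \<bar>x\<bar> < r \<and> \<bar>y\<bar> < r \<longrightarrow>
      ((\<lambda>q. c' p q * x ^ fst q * y ^ snd q) has_sum kbar (fst p) (snd p) (x, y)) UNIV)" ..
  from bchoice[OF this] obtain rK where rK: "\<forall>p\<in>?I \<times> ?I. rK p > 0 \<and> (\<forall>x y. \<bar>x\<bar> < rK p \<and> \<bar>y\<bar> < rK p \<longrightarrow>
      ((\<lambda>q. c' p q * x ^ fst q * y ^ snd q) has_sum kbar (fst p) (snd p) (x, y)) UNIV)" ..
  have K: "rK (i, j) > 0"
      "\<And>x y. \<bar>x\<bar> < rK (i, j) \<Longrightarrow> \<bar>y\<bar> < rK (i, j) \<Longrightarrow>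
        ((\<lambda>q. c' (i, j) q * x ^ fst q * y ^ snd q) has_sum kbar i j (x, y)) UNIV"
    if "i \<in> ?I" "j \<in> ?I" for i j
    using bspec[OF rK, of "(i, j)"] that by auto
  define c where "c i j = c' (i, j)" for i j

  \<comment> \<open>The element \<open>1\<close> keeps the radius at most \<open>1\<close>; halving
    the minimum puts \<open>R\<close> strictly inside every domain of convergence.\<close>
  define S where "S = insert 1 (rG ` ?I \<union> rK ` (?I \<times> ?I))"
  have S: "finite S" "\<And>r. r \<in> S \<Longrightarrow> r > 0"
    using G(1) K(1) by (auto simp: S_def)
  define R where "R = Min S / 2"
  have R: "R > 0" "R \<le> 1 / 2" "\<And>i. i \<in> ?I \<Longrightarrow> 2 * R \<le> rG i"
      "\<And>i j. i \<in> ?I \<Longrightarrow> j \<in> ?I \<Longrightarrow> 2 * R \<le> rK (i, j)"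
  proof -
    have "Min S > 0"
      using S by (subst Min_gr_iff) (auto simp: S_def)
    then show "R > 0" by (simp add: R_def)
    have le: "2 * R \<le> r" if "r \<in> S" for r
      using S(1) that by (simp add: R_def)
    show "R \<le> 1 / 2" using le[of 1] by (simp add: S_def)
    show "2 * R \<le> rG i" if "i \<in> ?I" for i
      using that by (intro le) (auto simp: S_def)
    show "2 * R \<le> rK (i, j)" if "i \<in> ?I" "j \<in> ?I" for i j
      using that by (intro le) (auto simp: S_def)
  qed
  \<comment> \<open>Unordered convergence at \<open>(R, R)\<close> is absolute. The resulting
    \<open>B i j\<close> bounds the kernel norm for every smaller radius, so \<open>\<rho>\<close>
    can be chosen after it.\<close>
  define B where "B i j = (\<Sum>\<^sub>\<infinity>x. \<bar>c i j x\<bar> * R ^ fst x * R ^ snd x)" for i j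
  have R_summable: "(\<lambda>x. \<bar>c i j x\<bar> * R ^ fst x * R ^ snd x) summable_on UNIV"
    if ij: "i \<in> ?I" "j \<in> ?I" for i j
  proof -
    have "((\<lambda>q. c i j q * R ^ fst q * R ^ snd q) has_sum kbar i j (R, R)) UNIV"
      unfolding c_def using R(1) R(4)[OF ij] by (intro K(2) ij) auto
    then have "(\<lambda>q. norm (c i j q * R ^ fst q * R ^ snd q)) summable_on UNIV"
      by (rule summable_on_iff_abs_summable_on_real[THEN iffD1, OF has_sum_imp_summable])
    then show ?thesis
      using R(1) by (simp add: abs_mult)
  qed
  have B_nonneg: "B i j \<ge> 0" for i j
    unfolding B_def using R(1) by (intro infsum_nonneg) auto
  define M where "M = (\<Sum>i\<in>?I. \<Sum>j\<in>?I. B i j / \<alpha> i j)"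
  have M: "M \<ge> 0"
    unfolding M_def using B_nonneg alpha by (intro sum_nonneg divide_nonneg_pos) auto
  \<comment> \<open>With \<open>M\<close> bounding the double sum of \<open>small\<close>, the
    product is at most \<open>M / (2 * (M + 1)) \<le> 1 / 2\<close>; the added \<open>1\<close>
    covers \<open>M = 0\<close>.\<close>
  define \<rho> where "\<rho> = min R (1 / (2 * (M + 1)))"
  have rho_R: "0 < \<rho>" "\<rho> \<le> R"
    using R(1) M by (auto simp: \<rho>_def)
  have le: "\<bar>c i j x\<bar> * \<rho> ^ fst x * \<rho> ^ snd x \<le> \<bar>c i j x\<bar> * R ^ fst x * R ^ snd x" for i j x
    using rho_R by (intro mult_mono power_mono) auto
  interpret abel_system n \<gamma> \<nu> \<alpha> G c \<rho>
  proof
    show "\<gamma> > 0" by (rule gamma)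
    show "0 < \<rho>" "\<rho> \<le> 1" using rho_R R(2) by auto
    show "\<nu> i j \<ge> 1" "\<alpha> i j > 0" if "i \<in> ?I" "j \<in> ?I" for i j
      using nu_alpha alpha that by auto
    show "summable (\<lambda>\<mu>. \<bar>G i \<mu>\<bar> * \<rho> ^ \<mu>)" if i: "i \<in> ?I" for i
    proof -
      \<comment> \<open>The point \<open>3 / 2 * R\<close> lies strictly between
        \<open>\<rho>\<close> and \<open>rG i\<close>, and convergence there yields absolute
        convergence at \<open>\<rho>\<close>.\<close>
      have "summable (\<lambda>\<mu>. G i \<mu> * (3 / 2 * R) ^ \<mu>)"
        using R(1) R(3)[OF i] by (intro sums_summable[OF G(2)[OF i]]) auto
      from powser_insidea[OF this, of \<rho>] rho_R R(1) show ?thesis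
        by (simp add: abs_mult power_abs)
    qed
    show summ: "(\<lambda>x. \<bar>c i j x\<bar> * \<rho> ^ fst x * \<rho> ^ snd x) summable_on UNIV"
      if "i \<in> ?I" "j \<in> ?I" for i j
      by (rule summable_on_comparison_test[OF R_summable[OF that] le]) (use rho_R in auto)
    have "(\<Sum>i\<in>?I. \<Sum>j\<in>?I. (\<Sum>\<^sub>\<infinity>x. \<bar>c i j x\<bar> * \<rho> ^ fst x * \<rho> ^ snd x) / \<alpha> i j) \<le> M"
      unfolding M_def B_def
      by (intro sum_mono divide_right_mono infsum_mono summ R_summable le less_imp_le alpha)
    then have "\<rho> * (\<Sum>i\<in>?I. \<Sum>j\<in>?I. (\<Sum>\<^sub>\<infinity>x. \<bar>c i j x\<bar> * \<rho> ^ fst x * \<rho> ^ snd x) / \<alpha> i j) \<le> 1 / (2 * (M + 1)) * M"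
      using rho_R M by (intro mult_mono') (auto simp: \<rho>_def intro!: sum_nonneg divide_nonneg_pos infsum_nonneg alpha)
    also have "\<dots> \<le> 1 / 2"
      using M by (simp add: field_simps)
    finally show "\<rho> * (\<Sum>i\<in>?I. \<Sum>j\<in>?I. (\<Sum>\<^sub>\<infinity>x. \<bar>c i j x\<bar> * \<rho> ^ fst x * \<rho> ^ snd x) / \<alpha> i j) \<le> 1 / 2" .
  qed
  have gbar_eq: "(\<Sum>\<mu>. G i \<mu> * z ^ \<mu>) = gbar i z" if "i \<in> ?I" "0 \<le> z" "z \<le> \<rho>" for i z
    using sums_unique[OF G(2)[of i z]] that rho_R R(1) R(3)[OF that(1)] by auto
  have kern_eq: "kern i j z w = kbar i j (z, w)"
    if "i \<in> ?I" "j \<in> ?I" "0 \<le> z" "z \<le> \<rho>" "0 \<le> w" "w \<le> \<rho>" for i j z w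
  proof (rule has_sum_unique[OF kern_has_sum[OF that]])
    show "((\<lambda>q. c i j q * z ^ fst q * w ^ snd q) has_sum kbar i j (z, w)) UNIV"
      unfolding c_def using R(1) R(4)[OF that(1,2)] that rho_R by (intro K(2)) auto
  qed

  \<comment> \<open>Comparison of a continuous solution with the series\<close>
  define \<delta> where "\<delta> = \<rho> ^ \<gamma>"
  have \<delta>: "0 < \<delta>" "\<delta> \<le> 1" "root \<gamma> \<delta> = \<rho>"
    using rho_R R(2) gamma by (auto simp: \<delta>_def real_root_power_cancel intro!: power_le_one)
  have root_le: "0 \<le> root \<gamma> t" "root \<gamma> t \<le> \<rho>" if "t \<in> {0..\<delta>}" for t
  proof -
    show "0 \<le> root \<gamma> t" using that by (auto intro: real_root_ge_zero)
    have "root \<gamma> t \<le> root \<gamma> \<delta>" using that gamma by simp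
    then show "root \<gamma> t \<le> \<rho>" by (simp add: \<delta>(3))
  qed
  have k_kern: "k i j (t, s) = kern i j (root \<gamma> t) (root \<gamma> s)"
    if "i \<in> ?I" "j \<in> ?I" "0 \<le> s" "s \<le> t" "t \<le> \<delta>" for i j t s
    using assms(9)[of i j t s] kern_eq[of i j "root \<gamma> t" "root \<gamma> s"] root_le[of t] root_le[of s] that \<delta>(2)
    by (auto simp: triangle_D_def)
  have series: "has_fractional_series \<gamma> (y i) (\<lambda>\<mu>. ycoeff \<mu> i) \<delta>"
    if sol: "continuous_volterra_solution n \<alpha> g k y" and i: "i \<in> ?I" for y i
  proof -
    have y_cont: "continuous_on {0..1} (y i)" if "i \<in> ?I" for i
      using sol that unfolding continuous_volterra_solution_def by blast
    have Y_cont: "continuous_on {0..\<delta>} (\<lambda>t. Y i (root \<gamma> t))" if "i \<in> ?I" for i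
      by (rule continuous_on_compose2[OF Y_continuous[OF that]])
        (use root_le in \<open>auto intro!: continuous_intros\<close>)
    \<comment> \<open>The inhomogeneity is the same for \<open>y\<close> and for the series, so it
      cancels and \<open>u\<close> solves the homogeneous system.\<close>
    define u where "u i t = y i t - Y i (root \<gamma> t)" for i t
    have "u i t = 0" if t: "t \<in> {0..\<delta>}" for t
    proof (rule homogeneous_solution_zero[OF _ \<delta>(2) _ assms(7) _ _ _ i t])
      show "0 \<le> \<delta>" "root \<gamma> \<delta> \<le> \<rho>" using \<delta> by auto
      show "\<bar>k i j (t, s)\<bar> \<le> A i j" if "i \<in> ?I" "j \<in> ?I" "0 \<le> s" "s \<le> t" "t \<le> \<delta>" for i j t s
        unfolding k_kern[OF that] using that by (intro kern_bound root_le) auto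
      show "continuous_on {0..\<delta>} (u i)" if "i \<in> ?I" for i
        unfolding u_def
        by (intro continuous_on_diff Y_cont continuous_on_subset[OF y_cont] that) (use \<delta> in auto)
      fix i t assume i: "i \<in> ?I" and t: "t \<in> {0..\<delta>}"
      define z where "z = root \<gamma> t"
      note z = root_le[OF t, folded z_def]
      have t01: "t \<in> {0..1}" using t \<delta>(2) by auto
      have tv: "t * v \<in> {0..\<delta>}" "t * v \<le> t" "0 \<le> t * v" if "v \<in> {0..1}" for v
      proof -
        show "t * v \<le> t" "0 \<le> t * v" using that t by (auto intro: mult_left_le)
        then show "t * v \<in> {0..\<delta>}" using t by auto
      qed
      have y_int: "integral {0..t} (\<lambda>s. (t - s) powr (\<alpha> i j - 1) * k i j (t, s) * y j s)
          = z ^ \<nu> i j * abel_int (\<alpha> i j) (\<lambda>v. k i j (t, t * v) * y j (t * v))" if j: "j \<in> ?I" for j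
      proof -
        have "t powr \<alpha> i j = z ^ \<nu> i j"
          unfolding z_def using t gamma nu_alpha[OF i j] by (intro powr_rational_eq_root_power) auto
        then show ?thesis
          using integral_abel_stretch[of t "\<alpha> i j" "\<lambda>s. k i j (t, s) * y j s"] t alpha[OF i j]
          by (simp add: mult.assoc)
      qed
      have "y i t = g i t + (\<Sum>j=1..n. integral {0..t} (\<lambda>s. (t - s) powr (\<alpha> i j - 1) * k i j (t, s) * y j s))"
        using sol i t01 unfolding continuous_volterra_solution_def by blast
      then have y_eq: "y i t = gbar i z + (\<Sum>j=1..n. z ^ \<nu> i j * abel_int (\<alpha> i j) (\<lambda>v. k i j (t, t * v) * y j (t * v)))"
        using assms(8)[OF i t01] y_int by (simp add: z_def)
      \<comment> \<open>Multiplicativity of the root gives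
        \<open>root \<gamma> (t * v) = z * root \<gamma> v\<close>, which translates
        \<open>Y_equation\<close> back to the variable \<open>t\<close>.\<close>
      have "abel_int (\<alpha> i j) (\<lambda>v. kern i j z (z * root \<gamma> v) * Y j (z * root \<gamma> v)) =
          abel_int (\<alpha> i j) (\<lambda>v. k i j (t, t * v) * Y j (root \<gamma> (t * v)))" if j: "j \<in> ?I" for j
      proof (rule abel_int_cong)
        fix v :: real assume v: "v \<in> {0..1}"
        then show "kern i j z (z * root \<gamma> v) * Y j (z * root \<gamma> v) = k i j (t, t * v) * Y j (root \<gamma> (t * v))"
          using k_kern[OF i j tv(3,2)[OF v]] t by (simp add: z_def real_root_mult)
      qed
      then have Y_eq: "Y i z = gbar i z + (\<Sum>j=1..n. z ^ \<nu> i j * abel_int (\<alpha> i j) (\<lambda>v. k i j (t, t * v) * Y j (root \<gamma> (t * v))))"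
        using Y_equation[OF i z] gbar_eq[OF i z] by simp
      have "abel_int (\<alpha> i j) (\<lambda>v. k i j (t, t * v) * u j (t * v)) =
          abel_int (\<alpha> i j) (\<lambda>v. k i j (t, t * v) * y j (t * v)) -
          abel_int (\<alpha> i j) (\<lambda>v. k i j (t, t * v) * Y j (root \<gamma> (t * v)))" if j: "j \<in> ?I" for j
      proof -
        have k_cont: "continuous_on {0..1} (\<lambda>v. k i j (t, t * v))"
          by (rule continuous_on_compose2[OF assms(7)[OF i j]])
            (use tv t01 in \<open>auto intro!: continuous_intros simp: triangle_D_def\<close>)
        have "continuous_on {0..1} (\<lambda>v. y j (t * v))"
          by (rule continuous_on_compose2[OF y_cont[OF j]])
            (use tv \<delta>(2) in \<open>fastforce intro!: continuous_intros\<close>)+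
        moreover have "continuous_on {0..1} (\<lambda>v. Y j (root \<gamma> (t * v)))"
          by (rule continuous_on_compose2[OF Y_cont[OF j]])
            (use tv in \<open>auto intro!: continuous_intros\<close>)
        ultimately show ?thesis
          unfolding u_def right_diff_distrib
          by (intro abel_int_diff alpha[OF i j] continuous_on_mult k_cont)
      qed
      then show "u i t = (\<Sum>j=1..n. root \<gamma> t ^ \<nu> i j * abel_int (\<alpha> i j) (\<lambda>v. k i j (t, t * v) * u j (t * v)))"
        unfolding z_def[symmetric] using y_eq Y_eq
        by (simp add: u_def[of i t] z_def[symmetric] right_diff_distrib sum_subtractf)
    qed
    then have "y i t = Y i (root \<gamma> t)" if "t \<in> {0..<\<delta>}" for t
      using that by (auto simp: u_def)
    then show ?thesis
      unfolding has_fractional_series_def using Y_sums[OF i] root_le by auto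
  qed
  show ?thesis
  proof (intro exI[of _ "\<lambda>i \<mu>. ycoeff \<mu> i"] exI[of _ \<delta>] conjI allI impI ballI)
    fix y i assume "continuous_volterra_solution n \<alpha> g k y" "i \<in> ?I"
    note ser = series[OF this]
    show "has_fractional_series \<gamma> (y i) (\<lambda>\<mu>. ycoeff \<mu> i) \<delta>" by (rule ser)
    fix d \<epsilon> assume "0 < \<epsilon> \<and> has_fractional_series \<gamma> (y i) d \<epsilon>"
    then show "d = (\<lambda>\<mu>. ycoeff \<mu> i)"
      using has_fractional_series_unique[OF gamma _ _ \<delta>(1) ser] by blast
  qed (use \<delta> in auto)
qed

end
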